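(* If $\diamond$ is associative then the associated generalized quasi-shuffle product $\hat{\mathbin{\sqcup\!\sqcup}}$ is associative.
   Context: Let $\mathcal{R}$ be a commutative ring with unit containing $\mathbb{Q}$, $L$ a set (of letters), and $\mathcal{R}\langle L\rangle$ the non-commutative polynomial ring in $L$; monic monomials are words, ${\bf 1}$ is the empty word, and $l(x)$ is the length of a word. Let $F:\mathcal{R}\langle L\rangle\to\mathcal{R}L+\mathcal{R}{\bf 1}$ be the $\mathcal{R}$-linear map sending a word $\alpha_1\cdots\alpha_n$ to its first letter $\alpha_1$ and ${\bf 1}$ to ${\bf 1}$. Let $R$ be the map sending $\sum_i c_i\alpha_{1,i}\cdots\alpha_{n_i,i}$ to the sum (after collecting like terms, with coefficients dropped) of the words with the first letter removed, $\alpha_{2,i}\cdots\alpha_{n_i,i}$; in particular $R(c\alpha)=R(c{\bf 1})={\bf 1}$. Let $\diamond:\mathcal{R}L\times\mathcal{R}L\to\mathcal{R}\langle L\rangle$ be $\mathcal{R}$-bilinear, and write $l(\alpha,\beta)$ for the length of $\alpha\diamond\beta$. $\diamond$ is decomposable if there is a word $w$ such that $R(\alpha\diamond\beta)=w$ for all $\alpha,\beta\in L$ with $R(\alpha\diamond\beta)\notin\mathcal{R}L$. A decomposable $\diamond$ is called associative if for all $\alpha,\beta,\gamma\in L$, $(F(\alpha\diamond\beta)\diamond\gamma)R(\alpha\diamond\beta)=(\alpha\diamond F(\beta\diamond\gamma))R(\beta\diamond\gamma)$, and for all $\alpha,\beta\in L$ with $l(\alpha,\beta)\ge 2$ and all $\gamma\in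 L$, $\gamma\diamond F(R(\alpha\diamond\beta))=-\gamma F(R(\alpha\diamond\beta))$. The generalized quasi-shuffle product $\hat{\mathbin{\sqcup\!\sqcup}}$ associated to $\diamond$ is the $\mathcal{R}$-bilinear product on $\mathcal{R}\langle L\rangle$ defined for non-empty words $x,y$ by $x\hat{\mathbin{\sqcup\!\sqcup}} y=F(x)(R(x)\hat{\mathbin{\sqcup\!\sqcup}} y)+F(y)(x\hat{\mathbin{\sqcup\!\sqcup}} R(y))+(F(x)\diamond F(y))(R(x)\hat{\mathbin{\sqcup\!\sqcup}} R(y))$, with ${\bf 1}\hat{\mathbin{\sqcup\!\sqcup}} x=x\hat{\mathbin{\sqcup\!\sqcup}}{\bf 1}=x$.
   Formalization: Added hypothesis: F(R(α⋄β))⋄γ = γ⋄F(R(α⋄β)) for all letters with l(α,β) ≥ 2 (automatic if ⋄ is commutative); without it the claim fails, e.g. α⋄β = −αw on L = {w,g}. *)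

theory Defs
  imports "HOL.Rat" "HOL-Library.Poly_Mapping"
begin

text \<open>
  The additive monoid structure on words is concatenation (the additive notation is only what
  \<open>Poly_Mapping\<close> expects for its convolution product).  With it, \<open>'a word \<Rightarrow>\<^sub>0 'r\<close> is the monoid
  ring of the free monoid on \<open>'a\<close>, i.e. the non-commutative polynomial ring over \<open>'r\<close> in the
  letters \<open>'a\<close>; its unit \<open>1\<close> is the empty word.
\<close>

datatype 'a word = Word (word_letters: "'a list")

instantiation word :: (type) monoid_add
begin

definition zero_word :: "'a word" where
  "0 = Word []"

definition plus_word :: "'a word \<Rightarrow> 'a word \<Rightarrow> 'a word" where
  "u + v = Word (word_letters u @ word_letters v)"

instance
  by standard (simp_all add: zero_word_def plus_word_def)

end

type_synonym ('a, 'r) ncpoly = "'a word \<Rightarrow>\<^sub>0 'r"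

definition contains_rat :: "'r::comm_ring_1 itself \<Rightarrow> bool" where
  "contains_rat _ \<longleftrightarrow> (\<exists>h :: rat \<Rightarrow> 'r. inj h \<and> h 1 = 1 \<and>
      (\<forall>p q. h (p + q) = h p + h q) \<and> (\<forall>p q. h (p * q) = h p * h q))"

definition of_word :: "'a list \<Rightarrow> ('a, 'r::comm_ring_1) ncpoly" where
  "of_word xs = Poly_Mapping.single (Word xs) 1"

abbreviation letter :: "'a \<Rightarrow> ('a, 'r::comm_ring_1) ncpoly" where
  "letter a \<equiv> of_word [a]"

definition scale :: "'r::comm_ring_1 \<Rightarrow> ('a, 'r) ncpoly \<Rightarrow> ('a, 'r) ncpoly" where
  "scale c p = Poly_Mapping.map ((*) c) p"

text \<open>The span of the letters; it contains neither \<open>1\<close> nor any other non-zero constant.\<close>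

definition letter_span :: "('a, 'r::comm_ring_1) ncpoly set" where
  "letter_span = {p. \<forall>w \<in> Poly_Mapping.keys p. length (word_letters w) = 1}"

definition first :: "('a, 'r::comm_ring_1) ncpoly \<Rightarrow> ('a, 'r) ncpoly" where
  "first p = (\<Sum>w \<in> Poly_Mapping.keys p.
      scale (Poly_Mapping.lookup p w) (of_word (take 1 (word_letters w))))"

text \<open>
  Coefficients are dropped and like terms are collected, so every word that occurs as a tail
  contributes exactly once: this is a sum over the \<^emph>\<open>set\<close> of tails.  The map is not linear;
  \<open>rest 0 = 0\<close>, and \<open>rest p = 1\<close> for every non-zero \<open>p\<close> in the span of the letters.
\<close>

definition rest :: "('a, 'r::comm_ring_1) ncpoly \<Rightarrow> ('a, 'r) ncpoly" where
  "rest p = (\<Sum>xs \<in> (\<lambda>w. tl (word_letters w)) ` Poly_Mapping.keys p. of_word xs)"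

definition poly_length :: "('a, 'r::comm_ring_1) ncpoly \<Rightarrow> nat" where
  "poly_length p = Max (insert 0 ((\<lambda>w. length (word_letters w)) ` Poly_Mapping.keys p))"

text \<open>
  A product \<open>\<diamondop>\<close> is only meaningful on the span of the letters; its values elsewhere
  are arbitrary and are never used.
\<close>

type_synonym ('a, 'r) diamond = "('a, 'r) ncpoly \<Rightarrow> ('a, 'r) ncpoly \<Rightarrow> ('a, 'r) ncpoly"

definition diamond_bilinear :: "('a, 'r::comm_ring_1) diamond \<Rightarrow> bool" where
  "diamond_bilinear d \<longleftrightarrow>
     (\<forall>p \<in> letter_span. \<forall>q \<in> letter_span. \<forall>r \<in> letter_span. \<forall>c.
        d (p + q) r = d p r + d q r \<and> d (scale c p) r = scale c (d p r) \<and>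
        d r (p + q) = d r p + d r q \<and> d r (scale c p) = scale c (d r p))"

definition decomposable :: "('a, 'r::comm_ring_1) diamond \<Rightarrow> bool" where
  "decomposable d \<longleftrightarrow>
     (\<exists>w. \<forall>a b. rest (d (letter a) (letter b)) \<notin> letter_span \<longrightarrow>
        rest (d (letter a) (letter b)) = of_word w)"

text \<open>
  The first clause says that \<open>F (\<alpha> \<diamondop> \<beta>)\<close> lies in the domain of \<open>\<diamondop>\<close>, so that
  the second one is meaningful; it amounts to \<open>\<alpha> \<diamondop> \<beta>\<close> having no constant term.
\<close>

definition diamond_assoc :: "('a, 'r::comm_ring_1) diamond \<Rightarrow> bool" where
  "diamond_assoc d \<longleftrightarrow>
     (\<forall>a b. first (d (letter a) (letter b)) \<in> letter_span) \<and>
     (\<forall>a b c. d (first (d (letter a) (letter b))) (letter c) * rest (d (letter a) (letter b)) =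
              d (letter a) (first (d (letter b) (letter c))) * rest (d (letter b) (letter c))) \<and>
     (\<forall>a b c. 2 \<le> poly_length (d (letter a) (letter b)) \<longrightarrow>
        d (letter c) (first (rest (d (letter a) (letter b)))) =
        - (letter c * first (rest (d (letter a) (letter b)))))"

text \<open>
  The element \<open>F (R (\<alpha> \<diamondop> \<beta>))\<close> commutes with every letter under \<open>\<diamondop>\<close> whenever
  \<open>\<alpha> \<diamondop> \<beta>\<close> is longer than one letter.  This is automatic if \<open>\<diamondop>\<close> is commutative or
  takes values in the span of the letters.  It does not follow from \<open>diamond_assoc\<close>, and
  without it the quasi-shuffle product need not be associative: with at least two letters, one
  of them being \<open>w\<close>, put \<open>\<alpha> \<diamondop> \<beta> = - \<alpha> w\<close> for all letters \<open>\<alpha>\<close>, \<open>\<beta>\<close>; then \<open>\<diamondop>\<close>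
  is decomposable and satisfies \<open>diamond_assoc\<close>, but bracketing the product of \<open>w\<close>, \<open>w\<close> and
  a letter \<open>g \<noteq> w\<close> to the left or to the right gives different coefficients of \<open>w g w\<close>.
\<close>

definition diamond_tail_comm :: "('a, 'r::comm_ring_1) diamond \<Rightarrow> bool" where
  "diamond_tail_comm d \<longleftrightarrow>
     (\<forall>a b c. 2 \<le> poly_length (d (letter a) (letter b)) \<longrightarrow>
        d (first (rest (d (letter a) (letter b)))) (letter c) =
        d (letter c) (first (rest (d (letter a) (letter b)))))"

fun qsh_word :: "('a, 'r::comm_ring_1) diamond \<Rightarrow> 'a list \<Rightarrow> 'a list \<Rightarrow> ('a, 'r) ncpoly" where
  "qsh_word d [] ys = of_word ys"
| "qsh_word d xs [] = of_word xs"
| "qsh_word d (a # xs) (b # ys) =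
     letter a * qsh_word d xs (b # ys) + letter b * qsh_word d (a # xs) ys +
     d (letter a) (letter b) * qsh_word d xs ys"

definition qsh :: "('a, 'r::comm_ring_1) diamond \<Rightarrow> ('a, 'r) ncpoly \<Rightarrow> ('a, 'r) ncpoly \<Rightarrow> ('a, 'r) ncpoly" where
  "qsh d p q = (\<Sum>u \<in> Poly_Mapping.keys p. \<Sum>v \<in> Poly_Mapping.keys q.
      scale (Poly_Mapping.lookup p u * Poly_Mapping.lookup q v)
        (qsh_word d (word_letters u) (word_letters v)))"

end

theory Submission
  imports Defs
begin

text \<open>
  The product must satisfy a rigid structure before the usual quasi-shuffle induction applies.
  If \<open>\<alpha> \<diamondop> \<beta>\<close> contains a word of length at least two, let \<open>s = F (R (\<alpha> \<diamondop> \<beta>))\<close>, a sum of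
  distinct letters.  The hypotheses give \<open>s \<diamondop> \<gamma> = \<gamma> \<diamondop> s = - \<gamma> s\<close> for all letters \<open>\<gamma>\<close>; hence
  any two such \<open>s\<close> commute as polynomials and therefore coincide, and left multiplication by
  \<open>s\<close> can be pulled out of either factor of the quasi-shuffle product.  If \<open>s\<close> is a single letter
  \<open>t\<close>, the associativity condition with \<open>\<alpha> = t\<close> forces every \<open>R (\<beta> \<diamondop> \<gamma>)\<close> to be a power of \<open>t\<close>
  or zero.  If \<open>s\<close> has \<open>k \<ge> 2\<close> letters, summing that condition over them gives
  \<open>k (\<beta> \<diamondop> \<gamma>) = F (\<beta> \<diamondop> \<gamma>) s\<close> for all \<open>\<beta>\<close> and \<open>\<gamma>\<close>, and \<open>k\<close> is invertible.  In each case
  \<open>\<alpha> \<diamondop> \<beta> = m(\<alpha>, \<beta>) W(\<alpha>, \<beta>)\<close> with \<open>m\<close> in the span of the letters and \<open>W\<close> pulling out of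
  products, and associativity follows by induction on the total length of three words.
\<close>

section \<open>Linear algebra of words\<close>

lemma all_word: "(\<forall>w. P w) \<longleftrightarrow> (\<forall>xs. P (Word xs))"
  by (metis word.exhaust)

lemma scale_conv_mult: "scale c p = Poly_Mapping.single 0 c * p"
  by (simp add: scale_def mult_map_scale_conv_mult)

lemma lookup_scale: "Poly_Mapping.lookup (scale c p) w = c * Poly_Mapping.lookup p w"
  unfolding scale_def by (simp add: map.rep_eq when_def)

lemma scale_simps [simp]:
  "scale c (p + q) = scale c p + scale c q"
  "scale c (p - q) = scale c p - scale c q"
  "scale c (- p) = - scale c p"
  "scale c 0 = 0"
  "scale 0 p = 0"
  "scale 1 p = p"
  "scale c (scale c' p) = scale (c * c') p"
  by (rule poly_mapping_eqI;
      simp add: lookup_scale lookup_add lookup_minus distrib_left right_diff_distrib mult.assoc)+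

lemma scale_add_left: "scale (c + c') p = scale c p + scale c' p"
  by (rule poly_mapping_eqI) (simp add: lookup_scale lookup_add distrib_right)

lemma scale_minus_left: "scale (- c) p = - scale c p"
  by (rule poly_mapping_eqI) (simp add: lookup_scale)

lemma scale_of_nat: "scale (of_nat k) p = of_nat k * p"
  by (simp add: scale_conv_mult)

lemma scale_sum: "scale c (\<Sum>x\<in>A. f x) = (\<Sum>x\<in>A. scale c (f x))"
  by (induction A rule: infinite_finite_induct) auto

lemma mult_scale_left [simp]: "scale c p * q = scale c (p * q)"
  by (simp add: scale_conv_mult mult.assoc)

lemma of_word_mult: "of_word xs * of_word ys = of_word (xs @ ys)"
  by (simp add: of_word_def mult_single plus_word_def)

lemma of_word_Nil: "of_word [] = 1"
  by (simp add: of_word_def zero_word_def flip: single_one)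

lemma letter_mult_of_word: "letter a * of_word xs = of_word (a # xs)"
  by (simp add: of_word_mult)

lemma lookup_of_word:
  "Poly_Mapping.lookup (of_word xs :: ('a, 'r::comm_ring_1) ncpoly) w = (if w = Word xs then 1 else 0)"
  by (auto simp: of_word_def lookup_single when_def)

lemma keys_of_word: "Poly_Mapping.keys (of_word xs :: ('a, 'r::comm_ring_1) ncpoly) = {Word xs}"
  by (simp add: of_word_def)

lemma ncpoly_expand:
  "p = (\<Sum>w\<in>Poly_Mapping.keys p. scale (Poly_Mapping.lookup p w) (of_word (word_letters w)))"
  by (rule poly_mapping_eqI)
     (simp add: lookup_sum lookup_scale lookup_of_word in_keys_iff
        if_distrib sum.delta cong: if_cong)

text \<open>\<open>p\<close> is the finite sum of its monomials, so only words of its support need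
  be treated; \<open>Q\<close> carries what is known about these words, for instance a prescribed
  length or tail.\<close>

lemma ncpoly_induct_on [consumes 1, case_names zero add scale]:
  assumes "\<forall>w\<in>Poly_Mapping.keys p. Q (word_letters w)"
    and zero: "P 0"
    and add: "\<And>p q. P p \<Longrightarrow> P q \<Longrightarrow> P (p + q)"
    and scale: "\<And>c xs. Q xs \<Longrightarrow> P (scale c (of_word xs))"
  shows "P p"
proof -
  have "P (\<Sum>w\<in>W. scale (Poly_Mapping.lookup p w) (of_word (word_letters w)))"
    if "finite W" "W \<subseteq> Poly_Mapping.keys p" for W
    using that by (induction W) (use assms in auto)
  then show ?thesis
    by (subst ncpoly_expand) simp
qed

lemma ncpoly_induct [case_names zero add scale]:
  assumes "P 0" "\<And>p q. P p \<Longrightarrow> P q \<Longrightarrow> P (p + q)" "\<And>c xs. P (scale c (of_word xs))"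
  shows "P p"
  by (rule ncpoly_induct_on[of p "\<lambda>_. True"]) (use assms in auto)

text \<open>Scaling is left multiplication by a constant, and constants are central: they commute
  with every word because the coefficient ring is commutative.\<close>

lemma mult_scale_right [simp]: "p * scale c q = scale c (p * q)"
proof (induction p rule: ncpoly_induct)
  case (scale a xs)
  have "of_word xs * Poly_Mapping.single 0 c = Poly_Mapping.single 0 c * of_word xs"
    by (simp add: of_word_def mult_single mult.commute)
  then have "of_word xs * scale c q = scale c (of_word xs * q)"
    by (simp add: scale_conv_mult flip: mult.assoc)
  then show ?case
    by (simp add: mult.commute)
qed (auto simp: distrib_right)

definition lin_ext :: "('a list \<Rightarrow> ('b, 'r::comm_ring_1) ncpoly) \<Rightarrow> ('a, 'r) ncpoly \<Rightarrow> ('b, 'r) ncpoly" where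
  "lin_ext g p = (\<Sum>w\<in>Poly_Mapping.keys p. scale (Poly_Mapping.lookup p w) (g (word_letters w)))"

text \<open>Cancellation can shrink supports; summing over a common larger index set makes
  additivity a termwise statement.\<close>

lemma lin_ext_superset:
  assumes "finite W" "Poly_Mapping.keys p \<subseteq> W"
  shows "lin_ext g p = (\<Sum>w\<in>W. scale (Poly_Mapping.lookup p w) (g (word_letters w)))"
  unfolding lin_ext_def
  by (rule sum.mono_neutral_left) (use assms in \<open>auto simp: in_keys_iff\<close>)

lemma lin_ext_simps [simp]:
  "lin_ext g 0 = 0"
  "lin_ext g (p + q) = lin_ext g p + lin_ext g q"
  "lin_ext g (scale c p) = scale c (lin_ext g p)"
  "lin_ext g (of_word xs) = g xs"
proof -
  show "lin_ext g 0 = 0" "lin_ext g (of_word xs) = g xs"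
    by (simp_all add: lin_ext_def keys_of_word lookup_of_word)
  let ?W = "Poly_Mapping.keys p \<union> Poly_Mapping.keys q"
  show "lin_ext g (p + q) = lin_ext g p + lin_ext g q"
    using keys_add[of p q]
    by (simp add: lin_ext_superset[of ?W] lookup_add scale_add_left sum.distrib)
  have "Poly_Mapping.keys (scale c p) \<subseteq> Poly_Mapping.keys p"
    by (auto simp: in_keys_iff lookup_scale)
  then show "lin_ext g (scale c p) = scale c (lin_ext g p)"
    by (simp add: lin_ext_superset[of "Poly_Mapping.keys p"] lookup_scale scale_sum)
qed

lemma lin_ext_add_fun: "lin_ext (\<lambda>u. g u + h u) p = lin_ext g p + lin_ext h p"
  by (simp add: lin_ext_def sum.distrib)

lemma lin_ext_scale_fun: "lin_ext (\<lambda>u. scale c (g u)) p = scale c (lin_ext g p)"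
  by (simp add: lin_ext_def scale_sum mult.commute)

lemma lin_ext_zero_fun: "lin_ext (\<lambda>u. 0) p = 0"
  by (simp add: lin_ext_def)

lemma first_conv_lin_ext: "first p = lin_ext (\<lambda>xs. of_word (take 1 xs)) p"
  by (simp add: first_def lin_ext_def)

lemma first_simps [simp]:
  "first 0 = 0"
  "first (p + q) = first p + first q"
  "first (scale c p) = scale c (first p)"
  "first (of_word xs) = of_word (take 1 xs)"
  by (simp_all add: first_conv_lin_ext)

lemma first_minus [simp]: "first (- p) = - first p"
  using first_simps(3)[of "- 1" p] by (simp add: scale_minus_left)

lemma first_sum: "first (\<Sum>x\<in>A. f x) = (\<Sum>x\<in>A. first (f x))"
  by (induction A rule: infinite_finite_induct) auto

lemma qsh_conv_lin_ext: "qsh d p q = lin_ext (\<lambda>u. lin_ext (qsh_word d u) q) p"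
  by (simp add: qsh_def lin_ext_def scale_sum)

lemma qsh_simps [simp]:
  "qsh d 0 q = 0"
  "qsh d (p + p') q = qsh d p q + qsh d p' q"
  "qsh d (scale c p) q = scale c (qsh d p q)"
  "qsh d p 0 = 0"
  "qsh d p (q + q') = qsh d p q + qsh d p q'"
  "qsh d p (scale c q) = scale c (qsh d p q)"
  by (simp_all add: qsh_conv_lin_ext lin_ext_add_fun lin_ext_scale_fun lin_ext_zero_fun)

lemma qsh_of_word: "qsh d (of_word xs) (of_word ys) = qsh_word d xs ys"
  by (simp add: qsh_conv_lin_ext)

lemma qsh_word_Nil_right [simp]: "qsh_word d xs [] = of_word xs"
  by (cases xs) auto

lemma qsh_1_left [simp]: "qsh d 1 q = q"
  by (induction q rule: ncpoly_induct) (auto simp: qsh_of_word simp flip: of_word_Nil)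

lemma qsh_1_right [simp]: "qsh d p 1 = p"
  by (induction p rule: ncpoly_induct) (auto simp: qsh_of_word simp flip: of_word_Nil)

section \<open>Homogeneous elements\<close>

definition homogeneous :: "nat \<Rightarrow> ('a, 'r::comm_ring_1) ncpoly set" where
  "homogeneous n = {p. \<forall>w \<in> Poly_Mapping.keys p. length (word_letters w) = n}"

lemma letter_span_conv_homogeneous: "letter_span = homogeneous 1"
  by (simp add: letter_span_def homogeneous_def)

lemma homogeneous_iff:
  "p \<in> homogeneous n \<longleftrightarrow> (\<forall>xs. length xs \<noteq> n \<longrightarrow> Poly_Mapping.lookup p (Word xs) = 0)"
  by (auto simp: homogeneous_def in_keys_iff Ball_def all_word)

lemma homogeneous_closed [intro]:
  "0 \<in> homogeneous n"
  "p \<in> homogeneous n \<Longrightarrow> q \<in> homogeneous n \<Longrightarrow> p + q \<in> homogeneous n"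
  "p \<in> homogeneous n \<Longrightarrow> q \<in> homogeneous n \<Longrightarrow> p - q \<in> homogeneous n"
  "p \<in> homogeneous n \<Longrightarrow> - p \<in> homogeneous n"
  "p \<in> homogeneous n \<Longrightarrow> scale c p \<in> homogeneous n"
  "length xs = n \<Longrightarrow> of_word xs \<in> homogeneous n"
  by (auto simp: homogeneous_iff lookup_add lookup_minus lookup_scale lookup_of_word)

lemma homogeneous_sum: "(\<And>x. x \<in> A \<Longrightarrow> f x \<in> homogeneous n) \<Longrightarrow> (\<Sum>x\<in>A. f x) \<in> homogeneous n"
  by (induction A rule: infinite_finite_induct) auto

lemma homogeneous_unique:
  assumes "p \<in> homogeneous m" "p \<in> homogeneous n" "m \<noteq> n"
  shows "p = 0"
proof (rule poly_mapping_eqI)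
  fix w :: "'a word"
  show "Poly_Mapping.lookup p w = Poly_Mapping.lookup 0 w"
  proof (cases w)
    case (Word xs)
    have "length xs \<noteq> m \<or> length xs \<noteq> n" using assms(3) by blast
    then have "Poly_Mapping.lookup p (Word xs) = 0"
      using assms(1,2) by (auto simp only: homogeneous_iff)
    then show ?thesis using Word by simp
  qed
qed

lemma letter_span_closed [intro, simp]:
  "0 \<in> letter_span"
  "p \<in> letter_span \<Longrightarrow> q \<in> letter_span \<Longrightarrow> p + q \<in> letter_span"
  "p \<in> letter_span \<Longrightarrow> - p \<in> letter_span"
  "p \<in> letter_span \<Longrightarrow> scale c p \<in> letter_span"
  "letter a \<in> letter_span"
  unfolding letter_span_conv_homogeneous by auto

lemma letter_span_sum:
  "(\<And>x. x \<in> A \<Longrightarrow> f x \<in> letter_span) \<Longrightarrow> (\<Sum>x\<in>A. f x) \<in> letter_span"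
  unfolding letter_span_conv_homogeneous by (rule homogeneous_sum)

text \<open>The sum case supplies membership of both summands because bilinearity of a diamond
  product is assumed only on the letter span.\<close>

lemma letter_span_induct [consumes 1, case_names zero add scale]:
  assumes p: "p \<in> letter_span" and "P 0"
    and add: "\<And>p q. p \<in> letter_span \<Longrightarrow> q \<in> letter_span \<Longrightarrow> P p \<Longrightarrow> P q \<Longrightarrow> P (p + q)"
    and scale: "\<And>c a. P (scale c (letter a))"
  shows "P p"
proof -
  have "\<forall>w\<in>Poly_Mapping.keys p. length (word_letters w) = 1"
    using p by (simp add: letter_span_def)
  then have "p \<in> letter_span \<and> P p"
  proof (induction p rule: ncpoly_induct_on)
    case (scale c xs)
    then show ?case using assms(4) by (auto simp: length_Suc_conv)
  qed (use assms in auto)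
  then show ?thesis ..
qed

lemma first_letter_span [simp]: "p \<in> letter_span \<Longrightarrow> first p = p"
  by (induction p rule: letter_span_induct) auto

section \<open>Coefficients of products with a factor in the letter span\<close>

lemma lookup_mult_letter_left:
  "Poly_Mapping.lookup (letter a * q) (Word (b # ys)) =
     (if a = b then Poly_Mapping.lookup q (Word ys) else 0)"
  by (induction q rule: ncpoly_induct)
     (auto simp: distrib_left lookup_add lookup_scale lookup_of_word of_word_mult)

lemma lookup_mult_letter_right:
  "Poly_Mapping.lookup (p * letter a) (Word (ys @ [b])) =
     (if a = b then Poly_Mapping.lookup p (Word ys) else 0)"
  by (induction p rule: ncpoly_induct)
     (auto simp: distrib_right lookup_add lookup_scale lookup_of_word of_word_mult)

lemma lookup_letter_span_mult:
  "p \<in> letter_span \<Longrightarrow> Poly_Mapping.lookup (p * q) (Word (x # ys)) =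
     Poly_Mapping.lookup p (Word [x]) * Poly_Mapping.lookup q (Word ys)"
  by (induction p rule: letter_span_induct)
     (auto simp: distrib_right lookup_add lookup_scale lookup_mult_letter_left lookup_of_word)

lemma lookup_mult_letter_span:
  "q \<in> letter_span \<Longrightarrow> Poly_Mapping.lookup (p * q) (Word (ys @ [x])) =
     Poly_Mapping.lookup p (Word ys) * Poly_Mapping.lookup q (Word [x])"
  by (induction q rule: letter_span_induct)
     (auto simp: distrib_left lookup_add lookup_scale lookup_mult_letter_right lookup_of_word)

text \<open>Since \<open>rest\<close> drops coefficients, tails consisting of single letters add up
  to such a sum, and the set \<open>T\<close> determines it.\<close>

definition letter_sum :: "'a set \<Rightarrow> ('a, 'r::comm_ring_1) ncpoly" where
  "letter_sum T = (\<Sum>t\<in>T. letter t)"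

lemma letter_sum_in_letter_span [simp]: "letter_sum T \<in> letter_span"
  unfolding letter_sum_def by (rule letter_span_sum) simp

lemma letter_sum_singleton [simp]: "letter_sum {t} = letter t"
  by (simp add: letter_sum_def)

lemma lookup_letter_sum:
  "finite T \<Longrightarrow> Poly_Mapping.lookup (letter_sum T) (Word [x]) = of_bool (x \<in> T)"
  by (simp add: letter_sum_def lookup_sum lookup_of_word)

text \<open>For \<open>t\<close> in \<open>T\<close>, the coefficient of the word \<open>w\<close>
  followed by \<open>t\<close> in the product is the coefficient of \<open>w\<close> in the left
  factor, because \<open>t\<close> has coefficient 1.\<close>

lemma letter_sum_right_cancel:
  fixes p q :: "('a, 'r::comm_ring_1) ncpoly"
  assumes "p * letter_sum T = q * letter_sum T" "finite T" "T \<noteq> {}"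
  shows "p = q"
proof (rule poly_mapping_eqI)
  fix w :: "'a word"
  obtain t where t: "t \<in> T" using assms by blast
  have "Poly_Mapping.lookup (p * letter_sum T) (Word (word_letters w @ [t])) =
    Poly_Mapping.lookup (q * letter_sum T) (Word (word_letters w @ [t]))"
    using assms by simp
  then show "Poly_Mapping.lookup p w = Poly_Mapping.lookup q w"
    using t assms(2) by (simp add: lookup_mult_letter_span lookup_letter_sum)
qed

lemma letter_sum_commute_imp_eq:
  assumes "letter_sum S * letter_sum T = (letter_sum T * letter_sum S :: ('a, 'r::comm_ring_1) ncpoly)"
    and "finite S" "finite T" "S \<noteq> {}" "T \<noteq> {}"
  shows "S = T"
proof -
  have "Poly_Mapping.lookup (letter_sum S * letter_sum T :: ('a, 'r) ncpoly) (Word [x, y]) =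
      Poly_Mapping.lookup (letter_sum T * letter_sum S :: ('a, 'r) ncpoly) (Word [x, y])" for x y
    using assms(1) by simp
  then have "of_bool (x \<in> S \<and> y \<in> T) = (of_bool (x \<in> T \<and> y \<in> S) :: 'r)" for x y
    using assms(2,3)
    by (simp add: lookup_letter_span_mult lookup_letter_sum of_bool_conj)
  then have "x \<in> S \<and> y \<in> T \<longleftrightarrow> x \<in> T \<and> y \<in> S" for x y
    by (simp only: of_bool_eq_iff)
  then show ?thesis using assms(4,5) by blast
qed

section \<open>The maps F and R\<close>

lemma lookup_rest:
  "Poly_Mapping.lookup (rest p) (Word ys) =
     (if ys \<in> (\<lambda>w. tl (word_letters w)) ` Poly_Mapping.keys p then 1 else 0)"
  by (simp add: rest_def lookup_sum lookup_of_word)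


lemma lookup_first_Nil: "Poly_Mapping.lookup (first p) (Word []) = Poly_Mapping.lookup p (Word [])"
  by (induction p rule: ncpoly_induct) (auto simp: lookup_add lookup_scale lookup_of_word)

text \<open>\<open>first\<close> keeps the constant term, and elements of the letter span have
  none.\<close>

lemma no_constant_term:
  assumes "first p \<in> letter_span" "w \<in> Poly_Mapping.keys p"
  shows "word_letters w \<noteq> []"
proof
  assume "word_letters w = []"
  then have "w = Word []" by (cases w) simp
  moreover have "Poly_Mapping.lookup (first p) (Word []) = 0"
    using assms(1) by (simp add: letter_span_conv_homogeneous homogeneous_iff)
  ultimately show False
    using assms(2) by (simp add: lookup_first_Nil in_keys_iff)
qed

lemma rest_0 [simp]: "rest 0 = 0"
  by (simp add: rest_def)

lemma rest_letter_span:
  assumes "p \<in> letter_span" "p \<noteq> 0"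
  shows "rest p = 1"
proof -
  have "\<forall>w\<in>Poly_Mapping.keys p. tl (word_letters w) = []"
    using assms(1) by (auto simp: letter_span_def length_Suc_conv)
  then have "(\<lambda>w. tl (word_letters w)) ` Poly_Mapping.keys p = (\<lambda>_. []) ` Poly_Mapping.keys p"
    by (intro image_cong) auto
  then have "(\<lambda>w. tl (word_letters w)) ` Poly_Mapping.keys p = {[]}"
    using assms(2) by (simp add: image_constant_conv)
  then show ?thesis
    by (simp add: rest_def of_word_Nil)
qed

lemma short_in_letter_span:
  assumes "first p \<in> letter_span" "\<not> 2 \<le> poly_length p"
  shows "p \<in> letter_span"
  unfolding letter_span_def
proof safe
  fix w assume w: "w \<in> Poly_Mapping.keys p"
  then have "length (word_letters w) \<le> poly_length p"
    unfolding poly_length_def by (intro Max_ge) auto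
  then have "length (word_letters w) < 2"
    using assms(2) by linarith
  then show "length (word_letters w) = 1"
    using no_constant_term[OF assms(1) w] by (cases "word_letters w") auto
qed

text \<open>Every word of \<open>p\<close> is one letter followed by \<open>v\<close>, and
  \<open>first\<close> keeps the coefficients. With several tails such a factorisation can fail,
  since \<open>rest\<close> forgets which letter and coefficient belong to which tail.\<close>

lemma single_tail_factor:
  assumes "first p \<in> letter_span" "rest p = of_word v"
  shows "p = first p * of_word v"
proof -
  have "\<forall>w\<in>Poly_Mapping.keys p. \<exists>x. word_letters w = x # v"
  proof
    fix w assume w: "w \<in> Poly_Mapping.keys p"
    have "Poly_Mapping.lookup (rest p) (Word (tl (word_letters w))) = 1"
      using w by (simp add: lookup_rest)
    then have "tl (word_letters w) = v"
      using assms(2) by (simp add: lookup_of_word split: if_splits)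
    then show "\<exists>x. word_letters w = x # v"
      using no_constant_term[OF assms(1) w] by (cases "word_letters w") auto
  qed
  then show ?thesis
    by (induction p rule: ncpoly_induct_on) (auto simp: distrib_right of_word_mult)
qed

text \<open>A word of length at least two supplies a non-empty tail. If \<open>rest p\<close> lies
  in the letter span, all tails are single letters and all words have length two; otherwise the only
  tail is \<open>w\<close>, which is therefore non-empty.\<close>

lemma long_rest_cases:
  fixes p :: "('a, 'r::comm_ring_1) ncpoly"
  assumes p: "first p \<in> letter_span" "2 \<le> poly_length p"
    and R: "rest p \<in> letter_span \<or> rest p = of_word w"
  obtains T where "finite T" "T \<noteq> {}" "rest p = letter_sum T" "p \<in> homogeneous 2"
  | t v where "rest p = of_word (t # v)"
proof -
  define A where "A = (\<lambda>w. tl (word_letters w)) ` Poly_Mapping.keys p"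
  have rest: "rest p = (\<Sum>xs\<in>A. of_word xs)" by (simp add: rest_def A_def)
  have A: "ys \<in> A \<longleftrightarrow> Poly_Mapping.lookup (rest p) (Word ys) \<noteq> 0" for ys
    by (simp add: lookup_rest A_def)
  have fin: "finite A" by (simp add: A_def)
  have "poly_length p \<in> insert 0 ((\<lambda>w. length (word_letters w)) ` Poly_Mapping.keys p)"
    unfolding poly_length_def by (rule Max_in) auto
  then obtain w0 where w0: "w0 \<in> Poly_Mapping.keys p" "length (word_letters w0) \<ge> 2"
    using p(2) by auto
  then have tl0: "tl (word_letters w0) \<in> A" "tl (word_letters w0) \<noteq> []"
    by (auto simp: A_def) (cases "word_letters w0"; auto)
  show ?thesis
  proof (cases "rest p \<in> letter_span")
    case True
    then have len: "length xs = 1" if "xs \<in> A" for xs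
      using that A by (auto simp: letter_span_conv_homogeneous homogeneous_iff)
    then have AT: "A = (\<lambda>t. [t]) ` (hd ` A)"
      by (force simp: image_image length_Suc_conv)
    have "rest p = letter_sum (hd ` A)"
      unfolding rest letter_sum_def by (subst AT, subst sum.reindex) (auto simp: inj_on_def)
    moreover have "p \<in> homogeneous 2"
      unfolding homogeneous_def
    proof safe
      fix w assume w: "w \<in> Poly_Mapping.keys p"
      then have "length (tl (word_letters w)) = 1" by (intro len) (auto simp: A_def)
      then show "length (word_letters w) = 2" by simp
    qed
    ultimately show ?thesis using that(1)[of "hd ` A"] fin tl0 by auto
  next
    case False
    then have R: "rest p = of_word w" using R by blast
    then have "tl (word_letters w0) = w"
      using tl0(1) A by (simp add: lookup_of_word split: if_splits)
    then show ?thesis using that(2) tl0(2) R by (cases w) auto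
  qed
qed

section \<open>Associativity for a factorised product\<close>

locale bilinear_diamond =
  fixes d :: "('a, 'r::comm_ring_1) diamond"
  assumes bilinear: "diamond_bilinear d"
begin

lemma diamond_simps [simp]:
  "p \<in> letter_span \<Longrightarrow> r \<in> letter_span \<Longrightarrow> d (scale c p) r = scale c (d p r)"
  "p \<in> letter_span \<Longrightarrow> r \<in> letter_span \<Longrightarrow> d r (scale c p) = scale c (d r p)"
  "p \<in> letter_span \<Longrightarrow> q \<in> letter_span \<Longrightarrow> r \<in> letter_span \<Longrightarrow> d (p + q) r = d p r + d q r"
  "p \<in> letter_span \<Longrightarrow> q \<in> letter_span \<Longrightarrow> r \<in> letter_span \<Longrightarrow> d r (p + q) = d r p + d r q"
  using bilinear unfolding diamond_bilinear_def by blast+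

lemma diamond_zero_minus [simp]:
  "r \<in> letter_span \<Longrightarrow> d 0 r = 0"
  "r \<in> letter_span \<Longrightarrow> d r 0 = 0"
  "p \<in> letter_span \<Longrightarrow> r \<in> letter_span \<Longrightarrow> d (- p) r = - d p r"
  "p \<in> letter_span \<Longrightarrow> r \<in> letter_span \<Longrightarrow> d r (- p) = - d r p"
  using diamond_simps(1,2)[of 0 r 0] diamond_simps(1,2)[of p r "- 1"]
  by (simp_all add: scale_minus_left)

lemma diamond_sum_left:
  assumes "\<And>x. x \<in> A \<Longrightarrow> f x \<in> letter_span" "r \<in> letter_span"
  shows "d (\<Sum>x\<in>A. f x) r = (\<Sum>x\<in>A. d (f x) r)"
  using assms(1)
  by (induction A rule: infinite_finite_induct) (auto simp: assms(2) letter_span_sum)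

section \<open>The recursion of the product, and elements that pull out of it\<close>

lemma qsh_letter_mult:
  "qsh d (letter a * X) (letter b * Y) =
     letter a * qsh d X (letter b * Y) + letter b * qsh d (letter a * X) Y
     + d (letter a) (letter b) * qsh d X Y"
proof (induction X rule: ncpoly_induct)
  case (scale c xs)
  show ?case
  proof (induction Y rule: ncpoly_induct)
    case (scale c' ys)
    show ?case by (simp add: letter_mult_of_word qsh_of_word)
  qed (auto simp: distrib_left algebra_simps)
qed (auto simp: distrib_left algebra_simps)

text \<open>Both sides are linear in \<open>p\<close> and \<open>q\<close>, so the recursion passes
  from letters to the letter span. This form applies to the heads \<open>m a b\<close>, which need
  not be letters.\<close>

lemma qsh_mult:
  assumes "p \<in> letter_span" "q \<in> letter_span"
  shows "qsh d (p * X) (q * Y) =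
     p * qsh d X (q * Y) + q * qsh d (p * X) Y + d p q * qsh d X Y"
  using assms
proof (induction p rule: letter_span_induct)
  case (scale c a)
  show ?case
    using scale.prems
  proof (induction q rule: letter_span_induct)
    case (scale c' b)
    show ?case by (simp add: qsh_letter_mult mult.commute[of c])
  qed (auto simp: algebra_simps)
qed (auto simp: algebra_simps)

definition pullable :: "('a, 'r) ncpoly \<Rightarrow> bool" where
  "pullable w \<longleftrightarrow>
     (\<forall>X Y. qsh d (w * X) Y = w * qsh d X Y \<and> qsh d X (w * Y) = w * qsh d X Y)"

lemma pullable_0: "pullable 0" and pullable_1: "pullable 1"
  by (simp_all add: pullable_def)

lemma pullable_mult: "pullable v \<Longrightarrow> pullable w \<Longrightarrow> pullable (v * w)"
  by (simp add: pullable_def mult.assoc)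

text \<open>Induction on the word in the other factor. In the recursion the term starting with its
  first letter \<open>c\<close> becomes \<open>letter c * s\<close> times a product by induction,
  and the diamond term cancels it; only the term starting with \<open>s\<close> remains.\<close>

lemma pullableI:
  assumes s: "s \<in> letter_span"
    and left: "\<And>c. d s (letter c) = - (letter c * s)"
    and right: "\<And>c. d (letter c) s = - (letter c * s)"
  shows "pullable s"
proof -
  have "qsh d (s * X) (of_word ys) = s * qsh d X (of_word ys)" for X ys
  proof (induction ys)
    case (Cons c ys)
    have "qsh d (s * X) (letter c * of_word ys) =
        s * qsh d X (letter c * of_word ys) + letter c * qsh d (s * X) (of_word ys)
        + d s (letter c) * qsh d X (of_word ys)"
      by (rule qsh_mult) (simp_all add: s)
    then show ?case
      by (simp add: Cons.IH left mult.assoc letter_mult_of_word)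
  qed (simp add: of_word_Nil)
  then have 1: "qsh d (s * X) Y = s * qsh d X Y" for X Y
    by (induction Y rule: ncpoly_induct) (auto simp: distrib_left)
  have "qsh d (of_word xs) (s * Y) = s * qsh d (of_word xs) Y" for xs Y
  proof (induction xs)
    case (Cons c xs)
    have "qsh d (letter c * of_word xs) (s * Y) =
        letter c * qsh d (of_word xs) (s * Y) + s * qsh d (letter c * of_word xs) Y
        + d (letter c) s * qsh d (of_word xs) Y"
      by (rule qsh_mult) (simp_all add: s)
    then show ?case
      by (simp add: Cons.IH right mult.assoc letter_mult_of_word)
  qed (simp add: of_word_Nil)
  then have 2: "qsh d X (s * Y) = s * qsh d X Y" for X Y
    by (induction X rule: ncpoly_induct) (auto simp: distrib_left)
  from 1 2 show ?thesis by (simp add: pullable_def)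
qed

text \<open>A word \<open>v\<close> commuting with the letter \<open>t\<close> is a power of
  \<open>t\<close>: its first letter is \<open>t\<close>, and the remaining word commutes with
  \<open>t\<close> again.\<close>

lemma pullable_of_word:
  assumes "pullable (letter t)" "v @ [t] = t # v"
  shows "pullable (of_word v)"
  using assms(2)
proof (induction v)
  case Nil
  show ?case by (simp add: of_word_Nil pullable_1)
next
  case (Cons a v)
  then have "a = t" "pullable (of_word v)" by auto
  then have "pullable (letter t * of_word v)"
    using assms(1) by (intro pullable_mult)
  then show ?case
    using \<open>a = t\<close> by (simp add: letter_mult_of_word)
qed

text \<open>Pulling out \<open>W\<close> lets both bracketings expand into seven terms. Six agree by
  induction; the seventh, where all three first letters are merged, also uses
  \<open>assoc\<close>.\<close>

lemma qsh_assoc_of_factorization: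
  assumes m: "\<And>a b. m a b \<in> letter_span"
    and fact: "\<And>a b. d (letter a) (letter b) = m a b * W a b"
    and pull: "\<And>a b. pullable (W a b)"
    and assoc: "\<And>a b c. d (m a b) (letter c) * W a b = d (letter a) (m b c) * W b c"
  shows "qsh d (qsh d x y) z = qsh d x (qsh d y z)"
proof -
  have pullL: "qsh d (W a b * X) Y = W a b * qsh d X Y"
    and pullR: "qsh d X (W a b * Y) = W a b * qsh d X Y" for a b X Y
    using pull by (auto simp: pullable_def)
  have words: "qsh d (qsh d (of_word us) (of_word vs)) (of_word ws) =
      qsh d (of_word us) (qsh d (of_word vs) (of_word ws))" for us vs ws
  proof (induction "length us + length vs + length ws" arbitrary: us vs ws rule: less_induct)
    case less
    show ?case
    proof (cases "us = [] \<or> vs = [] \<or> ws = []")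
      case True
      then show ?thesis by (auto simp: of_word_Nil)
    next
      case False
      then obtain a u b v c w where eq: "us = a # u" "vs = b # v" "ws = c # w"
        by (auto simp: neq_Nil_conv)
      define A B C :: "('a, 'r) ncpoly" where "A = of_word u" and "B = of_word v" and "C = of_word w"
      define aA bB cC where "aA = letter a * A" and "bB = letter b * B" and "cC = letter c * C"
      have word: "of_word us = aA" "of_word vs = bB" "of_word ws = cC"
        by (simp_all add: eq aA_def bB_def cC_def A_def B_def C_def letter_mult_of_word)
      \<comment> \<open>One instance for each way of removing the first letter from at least one of
        the three words.\<close>
      have IH: "qsh d (qsh d A bB) cC = qsh d A (qsh d bB cC)"
        "qsh d (qsh d aA B) cC = qsh d aA (qsh d B cC)"
        "qsh d (qsh d aA bB) C = qsh d aA (qsh d bB C)"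
        "qsh d (qsh d A bB) C = qsh d A (qsh d bB C)"
        "qsh d (qsh d aA B) C = qsh d aA (qsh d B C)"
        "qsh d (qsh d A B) cC = qsh d A (qsh d B cC)"
        "qsh d (qsh d A B) C = qsh d A (qsh d B C)"
        unfolding word[symmetric] A_def B_def C_def by (rule less; simp add: eq)+
      have ab: "qsh d aA bB = letter a * qsh d A bB + letter b * qsh d aA B
          + m a b * (W a b * qsh d A B)"
        unfolding aA_def bB_def by (subst qsh_mult) (simp_all add: fact mult.assoc)
      have bc: "qsh d bB cC = letter b * qsh d B cC + letter c * qsh d bB C
          + m b c * (W b c * qsh d B C)"
        unfolding bB_def cC_def by (subst qsh_mult) (simp_all add: fact mult.assoc)
      \<comment> \<open>Applied with \<open>p\<close> equal to \<open>letter a\<close>,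
        \<open>letter b\<close> and \<open>m a b\<close>; the three terms starting with
        \<open>letter c\<close> recombine to \<open>qsh d (qsh d aA bB) C\<close>.\<close>
      have L: "qsh d (p * X) cC = p * qsh d X cC + letter c * qsh d (p * X) C
          + d p (letter c) * qsh d X C" if "p \<in> letter_span" for p X
        unfolding cC_def by (rule qsh_mult) (simp_all add: that)
      have R: "qsh d aA (q * Y) = letter a * qsh d A (q * Y) + q * qsh d aA Y
          + d (letter a) q * qsh d A Y" if "q \<in> letter_span" for q Y
        unfolding aA_def by (rule qsh_mult) (simp_all add: that)
      have "qsh d (qsh d aA bB) cC =
          letter a * qsh d (qsh d A bB) cC + letter b * qsh d (qsh d aA B) cC
          + m a b * (W a b * qsh d (qsh d A B) cC)
          + letter c * qsh d (qsh d aA bB) C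
          + d (letter a) (letter c) * qsh d (qsh d A bB) C
          + d (letter b) (letter c) * qsh d (qsh d aA B) C
          + d (m a b) (letter c) * W a b * qsh d (qsh d A B) C"
        by (simp add: ab L m pullL distrib_left mult.assoc)
      also have "\<dots> =
          letter a * qsh d A (qsh d bB cC) + letter b * qsh d aA (qsh d B cC)
          + m a b * (W a b * qsh d A (qsh d B cC))
          + letter c * qsh d aA (qsh d bB C)
          + d (letter a) (letter c) * qsh d A (qsh d bB C)
          + m b c * (W b c * qsh d aA (qsh d B C))
          + d (letter a) (m b c) * W b c * qsh d A (qsh d B C)"
        by (simp only: IH assoc fact mult.assoc)
      also have "\<dots> = qsh d aA (qsh d bB cC)"
        by (simp add: bc R m pullR fact distrib_left mult.assoc)
      finally show ?thesis by (simp only: word)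
    qed
  qed
  show ?thesis
  proof (induction x rule: ncpoly_induct)
    case (scale c us)
    show ?case
    proof (induction y rule: ncpoly_induct)
      case (scale c' vs)
      show ?case
        by (induction z rule: ncpoly_induct) (simp_all add: words mult.assoc)
    qed simp_all
  qed simp_all
qed

end

section \<open>Factorising an associative product\<close>

text \<open>The inverse is the image of the rational 1/k under the embedding.\<close>

lemma of_nat_invertible:
  assumes "contains_rat TYPE('r::comm_ring_1)" "0 < k"
  shows "\<exists>i. i * of_nat k = (1 :: 'r)"
proof -
  obtain h :: "rat \<Rightarrow> 'r" where h: "h 1 = 1" "\<And>p q. h (p + q) = h p + h q" "\<And>p q. h (p * q) = h p * h q"
    using assms(1) unfolding contains_rat_def by blast
  have "h 0 = 0" using h(2)[of 0 0] by simp
  then have "h (of_nat n) = of_nat n" for n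
    by (induction n) (simp_all add: h)
  then have "h (inverse (of_nat k)) * of_nat k = h (inverse (of_nat k) * of_nat k)"
    by (simp add: h(3))
  also have "\<dots> = 1" using assms(2) h(1) by simp
  finally show ?thesis ..
qed

locale associative_diamond = bilinear_diamond d
  for d :: "('a, 'r::comm_ring_1) diamond" +
  assumes rational: "contains_rat TYPE('r)"
    and decomposable: "decomposable d"
    and associative: "diamond_assoc d"
    and tail_comm: "diamond_tail_comm d"
begin

abbreviation D :: "'a \<Rightarrow> 'a \<Rightarrow> ('a, 'r) ncpoly" where "D a b \<equiv> d (letter a) (letter b)"
abbreviation F :: "'a \<Rightarrow> 'a \<Rightarrow> ('a, 'r) ncpoly" where "F a b \<equiv> first (D a b)"
abbreviation R :: "'a \<Rightarrow> 'a \<Rightarrow> ('a, 'r) ncpoly" where "R a b \<equiv> rest (D a b)"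
abbreviation long :: "'a \<Rightarrow> 'a \<Rightarrow> bool" where "long a b \<equiv> 2 \<le> poly_length (D a b)"

lemma F_in_letter_span [simp]: "F a b \<in> letter_span"
  using associative by (simp add: diamond_assoc_def)

lemma assoc_FR: "d (F a b) (letter c) * R a b = d (letter a) (F b c) * R b c"
  using associative by (simp add: diamond_assoc_def)

lemma shortD: "\<not> long a b \<Longrightarrow> D a b \<in> letter_span"
  by (rule short_in_letter_span) auto

lemma short_R: "\<not> long a b \<Longrightarrow> D a b = 0 \<or> R a b = 1"
  using rest_letter_span[OF shortD] by blast

section \<open>Tails of products longer than one letter\<close>

lemma long_cases:
  assumes "long a b"
  obtains T where "finite T" "T \<noteq> {}" "R a b = letter_sum T" "D a b \<in> homogeneous 2"
  | t v where "R a b = of_word (t # v)"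
proof -
  obtain w where w: "R a b \<notin> letter_span \<Longrightarrow> R a b = of_word w"
    using decomposable unfolding decomposable_def by blast
  show ?thesis
    by (rule long_rest_cases[of "D a b" w]) (use assms w that in auto)
qed

text \<open>Either all tails are letters and \<open>T\<close> is their set, or there is one common
  tail and \<open>T\<close> consists of its first letter.\<close>

lemma long_imp_letter_sum:
  assumes "long a b"
  obtains T where "finite T" "T \<noteq> {}" "first (R a b) = letter_sum T"
  using assms
proof (cases rule: long_cases)
  case (1 T)
  then show ?thesis using that[of T] by simp
next
  case (2 t v)
  then show ?thesis using that[of "{t}"] by simp
qed

lemma diamond_tail_right:
  assumes "long a b" "p \<in> letter_span"
  shows "d p (first (R a b)) = - (p * first (R a b))"
proof -
  obtain T where T: "first (R a b) = letter_sum T"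
    using assms(1) by (rule long_imp_letter_sum)
  have "d (letter c) (letter_sum T) = - (letter c * letter_sum T)" for c
    using associative assms(1) T[symmetric] by (simp add: diamond_assoc_def)
  with assms(2) have "d p (letter_sum T) = - (p * letter_sum T)"
    by (induction p rule: letter_span_induct) (auto simp: distrib_right)
  then show ?thesis by (simp add: T)
qed

text \<open>\<open>diamond_tail_comm\<close> reduces this to the previous case, so \<open>p\<close>
  stays on the left of the polynomial product although it is the right factor of
  \<open>d\<close>.\<close>

lemma diamond_tail_left:
  assumes "long a b" "p \<in> letter_span"
  shows "d (first (R a b)) p = - (p * first (R a b))"
proof -
  obtain T where T: "first (R a b) = letter_sum T"
    using assms(1) by (rule long_imp_letter_sum)
  have "d (letter_sum T) (letter c) = - (letter c * letter_sum T)" for c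
    using tail_comm assms(1) diamond_tail_right[OF assms(1), of "letter c"] T[symmetric]
    by (simp add: diamond_tail_comm_def)
  with assms(2) have "d (letter_sum T) p = - (p * letter_sum T)"
    by (induction p rule: letter_span_induct) (auto simp: distrib_right)
  then show ?thesis by (simp add: T)
qed

text \<open>
  Two tails satisfy \<open>s \<diamondop> s' = - s s'\<close> and \<open>s \<diamondop> s' = - s' s\<close>, so they commute as
  polynomials.
\<close>

lemma long_tail_unique:
  assumes "long a b" "long a' b'"
  shows "first (R a b) = first (R a' b')"
proof -
  obtain S where S: "finite S" "S \<noteq> {}" "first (R a b) = letter_sum S"
    using assms(1) by (rule long_imp_letter_sum)
  obtain T where T: "finite T" "T \<noteq> {}" "first (R a' b') = letter_sum T"
    using assms(2) by (rule long_imp_letter_sum)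
  have "letter_sum S * letter_sum T = (letter_sum T * letter_sum S :: ('a, 'r) ncpoly)"
    using diamond_tail_right[OF assms(2), of "letter_sum S"]
      diamond_tail_left[OF assms(1), of "letter_sum T"] S T by simp
  then have "S = T" using S T by (intro letter_sum_commute_imp_eq)
  then show ?thesis using S T by simp
qed

lemma pullable_tail: "long a b \<Longrightarrow> pullable (first (R a b))"
  using diamond_tail_left[of a b] diamond_tail_right[of a b]
  by (intro pullableI) (auto elim!: long_imp_letter_sum)

text \<open>With heads \<open>F\<close> and tails \<open>R\<close>, the compatibility condition is
  the associativity condition itself. Short products are 0 or have tail 1, so only long ones need
  the premise.\<close>

lemma qsh_assoc_of_FR:
  assumes "\<And>a b. long a b \<Longrightarrow> \<exists>v. R a b = of_word v \<and> pullable (of_word v)"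
  shows "qsh d (qsh d x y) z = qsh d x (qsh d y z)"
proof (rule qsh_assoc_of_factorization[where m = F and W = R])
  fix a b
  show "D a b = F a b * R a b"
  proof (cases "long a b")
    case True
    then obtain v where "R a b = of_word v" using assms by blast
    moreover from this have "D a b = F a b * of_word v"
      by (intro single_tail_factor) simp_all
    ultimately show ?thesis by simp
  next
    case False
    then have "F a b = D a b" using shortD[of a b] by simp
    then show ?thesis using short_R[OF False] by (metis mult_1_right mult_zero_left)
  qed
  show "pullable (R a b)"
  proof (cases "long a b")
    case True
    then show ?thesis using assms[of a b] by auto
  next
    case False
    then show ?thesis using short_R[OF False] pullable_0 pullable_1 by auto
  qed
qed (simp_all add: assoc_FR)

text \<open>Associativity for \<open>t\<close>, \<open>b\<close>, \<open>c\<close> reads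
  \<open>f v t = f t v\<close> with \<open>f = F b c\<close> and \<open>v\<close> the tail of
  \<open>D b c\<close>. Cancelling \<open>f\<close> shows that \<open>v\<close> commutes with
  \<open>t\<close>, hence is pullable.\<close>

lemma qsh_assoc_of_letter_tail:
  assumes "long a\<^sub>0 b\<^sub>0" "first (R a\<^sub>0 b\<^sub>0) = letter t"
  shows "qsh d (qsh d x y) z = qsh d x (qsh d y z)"
proof (rule qsh_assoc_of_FR)
  fix b c assume bc: "long b c"
  then have tail: "first (R b c) = letter t"
    using assms long_tail_unique by metis
  obtain v where v: "R b c = of_word v"
    using bc
  proof (cases rule: long_cases)
    case (1 T)
    then have "R b c = of_word [t]" using tail by simp
    then show ?thesis by (rule that)
  qed (rule that)
  define f where "f = F b c"
  have f: "f \<in> letter_span" by (simp add: f_def)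
  have Df: "D b c = f * of_word v"
    unfolding f_def using v by (intro single_tail_factor) auto
  have left: "d (letter t) p = - (p * letter t)" if "p \<in> letter_span" for p
    using diamond_tail_left[OF assms(1) that] assms(2) by simp
  have tb: "D t b = - of_word [b, t]"
    by (simp add: left of_word_mult)
  then have "F t b = - letter b" by simp
  \<comment> \<open>The coefficient -1 is dropped by \<open>rest\<close>; the sign survives only in
    \<open>F t b\<close>.\<close>
  moreover have "R t b = letter t"
    by (simp add: tb rest_def keys_of_word)
  ultimately have "d (- letter b) (letter c) * letter t = d (letter t) f * of_word v"
    using assoc_FR[of t b c] v by (simp add: f_def)
  then have "f * of_word (v @ [t]) = f * of_word (t # v)"
    using f by (simp add: left Df mult.assoc of_word_mult)
  \<comment> \<open>A letter \<open>x\<close> occurring in \<open>f\<close> suffices to cancel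
    \<open>f\<close>: in \<open>f\<close> times a word \<open>u\<close>, the word \<open>x u\<close>
    has the coefficient of \<open>x\<close> in \<open>f\<close>, and no other word starting with
    \<open>x\<close> occurs.\<close>
  moreover obtain x where "Poly_Mapping.lookup f (Word [x]) \<noteq> 0"
  proof -
    have "f \<noteq> 0"
    proof
      assume "f = 0"
      then have "Poly_Mapping.keys (R b c) = {}" using Df by simp
      then show False by (simp add: v keys_of_word)
    qed
    then obtain w where w: "w \<in> Poly_Mapping.keys f"
      by (metis keys_eq_empty ex_in_conv)
    then have "length (word_letters w) = 1"
      using f by (simp add: letter_span_def)
    then obtain x where "w = Word [x]"
      by (cases w) (auto simp: length_Suc_conv)
    then show ?thesis using that w by (simp add: in_keys_iff)
  qed
  moreover have "Poly_Mapping.lookup (f * of_word u) (Word (x # u')) =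
      (if u' = u then Poly_Mapping.lookup f (Word [x]) else 0)" for x u u'
    using f by (simp add: lookup_letter_span_mult lookup_of_word)
  ultimately have vt: "v @ [t] = t # v"
    by (metis (no_types))
  have "pullable (letter t)"
    using pullable_tail[OF assms(1)] by (simp only: assms(2))
  then have "pullable (of_word v)"
    using vt by (rule pullable_of_word)
  then show "\<exists>v. R b c = of_word v \<and> pullable (of_word v)"
    using v by blast
qed

text \<open>The summed associativity condition is \<open>k D s = F s R\<close>. For long products
  \<open>R = s\<close>, and cancelling \<open>s\<close> gives \<open>k D = F s\<close>; for short
  non-zero ones \<open>R = 1\<close> and \<open>F = D\<close>, so \<open>(k - 1) D = 0\<close>,
  which is impossible.\<close>

lemma qsh_assoc_of_letter_sum_tail:
  assumes long0: "long a\<^sub>0 b\<^sub>0" and tail0: "first (R a\<^sub>0 b\<^sub>0) = letter_sum T"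
    and T: "finite T" "2 \<le> card T"
  shows "qsh d (qsh d x y) z = qsh d x (qsh d y z)"
proof -
  define s :: "('a, 'r) ncpoly" where "s = letter_sum T"
  define k where "k = card T"
  have s: "s \<in> letter_span" by (simp add: s_def)
  have Tne: "T \<noteq> {}" using T by auto
  have cancel: "p = q" if "p * s = q * s" for p q
    using that T(1) Tne unfolding s_def by (rule letter_sum_right_cancel)
  have tail: "first (R b c) = s" if "long b c" for b c
    using long_tail_unique[OF that long0] tail0 by (simp add: s_def)
  have left: "d s p = - (p * s)" if "p \<in> letter_span" for p
    using diamond_tail_left[OF long0 that] tail0 by (simp add: s_def)
  have long: "R b c = s" "D b c \<in> homogeneous 2" if "long b c" for b c
  proof -
    from that have "R b c = s \<and> D b c \<in> homogeneous 2"
    proof (cases rule: long_cases)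
      case (1 S)
      then show ?thesis using tail[OF that] by simp
    next
      case (2 t v)
      \<comment> \<open>A common tail starting with \<open>t\<close> would make \<open>T\<close> a
        singleton, so every long product falls under the first case.\<close>
      then have "letter t = s" using tail[OF that] by simp
      then have "letter_sum {t} * letter_sum T = (letter_sum T * letter_sum {t} :: ('a, 'r) ncpoly)"
        by (simp add: s_def)
      then have "{t} = T" using T(1) Tne by (intro letter_sum_commute_imp_eq) auto
      then show ?thesis using T(2) by auto
    qed
    then show "R b c = s" "D b c \<in> homogeneous 2" by auto
  qed
  have bs: "letter b * s = (\<Sum>t\<in>T. of_word [b, t])" for b
    by (simp add: s_def letter_sum_def sum_distrib_left of_word_mult)
  \<comment> \<open>Sum the associativity condition for \<open>t, b, c\<close> over the letters \<open>t\<close> of \<open>s\<close>.\<close>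
  have key: "scale (of_nat k) (D b c) * s = F b c * s * R b c" for b c
  proof -
    define T1 where "T1 = {t\<in>T. long t b}"
    define Y where "Y = (\<Sum>t\<in>T1. D t b)"
    define Z where "Z = (\<Sum>t\<in>T - T1. D t b)"
    have split: "(\<Sum>t\<in>T. f t) = (\<Sum>t\<in>T - T1. f t) + (\<Sum>t\<in>T1. f t)" for f :: "'a \<Rightarrow> ('a, 'r) ncpoly"
      by (rule sum.subset_diff) (auto simp: T1_def T)
    have "Z + Y = d s (letter b)"
      unfolding Y_def Z_def s_def letter_sum_def split[symmetric] by (subst diamond_sum_left) auto
    then have YZ: "Z + Y = - (letter b * s)" by (simp add: left)
    \<comment> \<open>The short products contribute degree 1, while \<open>Y\<close> and
      \<open>letter b * s\<close> have degree 2; hence the short part \<open>Z\<close>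
      vanishes.\<close>
    have "Z \<in> homogeneous 1"
      unfolding Z_def by (rule homogeneous_sum)
        (use shortD in \<open>auto simp: T1_def letter_span_conv_homogeneous\<close>)
    moreover have "Z \<in> homogeneous 2"
    proof -
      have "Y \<in> homogeneous 2"
        unfolding Y_def by (rule homogeneous_sum) (use long in \<open>auto simp: T1_def\<close>)
      moreover have "letter b * s \<in> homogeneous 2"
        unfolding bs by (rule homogeneous_sum) auto
      moreover have "Z = - (letter b * s) - Y" using YZ by (simp add: algebra_simps)
      ultimately show ?thesis by auto
    qed
    ultimately have Z0: "Z = 0" by (rule homogeneous_unique) simp
    \<comment> \<open>All \<open>k\<close> words of \<open>letter b * s\<close> start with
      \<open>b\<close>.\<close>
    then have "first Y = - scale (of_nat k) (letter b)"
      using YZ by (simp add: bs first_sum k_def scale_of_nat)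
    then have "(\<Sum>t\<in>T1. d (F t b) (letter c)) = - scale (of_nat k) (D b c)"
      unfolding Y_def first_sum by (subst diamond_sum_left[symmetric]) auto
    moreover have "(\<Sum>t\<in>T1. d (F t b) (letter c) * R t b) = (\<Sum>t\<in>T1. d (F t b) (letter c)) * s"
      unfolding sum_distrib_right by (rule sum.cong) (auto simp: T1_def long)
    moreover have "(\<Sum>t\<in>T - T1. d (F t b) (letter c) * R t b) = 0"
    proof -
      have "(\<Sum>t\<in>T - T1. d (F t b) (letter c) * R t b) = (\<Sum>t\<in>T - T1. d (F t b) (letter c))"
      proof (rule sum.cong)
        fix t assume "t \<in> T - T1"
        then have "D t b = 0 \<or> R t b = 1" by (intro short_R) (simp add: T1_def)
        then show "d (F t b) (letter c) * R t b = d (F t b) (letter c)" by auto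
      qed simp
      also have "\<dots> = d (first Z) (letter c)"
        unfolding Z_def first_sum by (subst diamond_sum_left) auto
      finally show ?thesis using Z0 by simp
    qed
    moreover have "(\<Sum>t\<in>T. d (letter t) (F b c) * R b c) = - (F b c * s * R b c)"
    proof -
      have "(\<Sum>t\<in>T. d (letter t) (F b c)) = d s (F b c)"
        unfolding s_def letter_sum_def by (subst diamond_sum_left) auto
      then show ?thesis by (simp add: left flip: sum_distrib_right)
    qed
    ultimately show ?thesis
      using split[of "\<lambda>t. d (F t b) (letter c) * R t b"] by (simp add: assoc_FR)
  qed
  have short: "D b c = 0" if "\<not> long b c" for b c
  proof (rule ccontr)
    assume "D b c \<noteq> 0"
    then have R1: "R b c = 1" using short_R[OF that] by blast
    have FD: "F b c = D b c" using shortD[OF that] by simp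
    have "scale (of_nat k) (D b c) * s = D b c * s"
      using key[of b c] by (simp only: FD R1 mult_1_right)
    then have kD: "scale (of_nat k) (D b c) = D b c" by (rule cancel)
    \<comment> \<open>Here \<open>n = k - 1\<close>, which is positive and therefore
      invertible.\<close>
    obtain n where n: "k = Suc n" "0 < n"
      using T(2) by (cases k) (auto simp: k_def)
    have "scale (of_nat n) (D b c) = 0"
      using kD by (simp add: n scale_add_left)
    moreover obtain i :: 'r where "i * of_nat n = 1"
      using of_nat_invertible[OF rational n(2)] by blast
    ultimately have "D b c = 0"
      using scale_simps(7)[of i "of_nat n" "D b c"] by simp
    with \<open>D b c \<noteq> 0\<close> show False ..
  qed
  have "0 < k" using T(2) by (simp add: k_def)
  then obtain i :: 'r where i: "i * of_nat k = 1"
    using of_nat_invertible[OF rational] by blast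
  have kD: "scale (of_nat k) (D b c) = F b c * s" for b c
  proof (cases "long b c")
    case True
    then show ?thesis using key[of b c] long(1)[OF True] by (simp only: cancel)
  next
    case False
    show ?thesis by (simp add: short[OF False])
  qed
  show ?thesis
  \<comment> \<open>\<open>F a b * s\<close> counts each product \<open>k\<close> times, so the head
    is divided by \<open>k\<close>. Taking \<open>s\<close> as tail for short products too is
    harmless, as these vanish.\<close>
  proof (rule qsh_assoc_of_factorization[where m = "\<lambda>a b. scale i (F a b)" and W = "\<lambda>_ _. s"])
    fix a b c
    show "scale i (F a b) \<in> letter_span" by simp
    have "D a b = scale i (scale (of_nat k) (D a b))" by (simp add: i)
    also have "\<dots> = scale i (F a b) * s" by (simp only: kD mult_scale_left)
    finally show "D a b = scale i (F a b) * s" .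
    show "pullable s" using pullable_tail[OF long0] tail0 by (simp add: s_def)
    have "d (F a b) (letter c) * s = d (F a b) (letter c) * R a b"
      using long(1)[of a b] short[of a b] by (cases "long a b") auto
    also have "\<dots> = d (letter a) (F b c) * R b c" by (rule assoc_FR)
    also have "\<dots> = d (letter a) (F b c) * s"
      using long(1)[of b c] short[of b c] by (cases "long b c") auto
    finally show "d (scale i (F a b)) (letter c) * s = d (letter a) (scale i (F b c)) * s"
      by simp
  qed
qed

text \<open>All long products share the same letter sum, so a single long pair decides between the
  two cases; if there is none, the premise of \<open>qsh_assoc_of_FR\<close> is vacuous.\<close>

theorem qsh_assoc: "qsh d (qsh d x y) z = qsh d x (qsh d y z)"
proof (cases "\<exists>a b. long a b")
  case True
  then obtain a b where ab: "long a b" by blast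
  then obtain T where T: "finite T" "T \<noteq> {}" "first (R a b) = letter_sum T"
    by (rule long_imp_letter_sum)
  show ?thesis
  proof (cases "2 \<le> card T")
    case True
    then show ?thesis using ab T by (intro qsh_assoc_of_letter_sum_tail)
  next
    case False
    moreover have "card T \<noteq> 0" using T by simp
    ultimately have "card T = 1" by linarith
    then obtain t where "T = {t}" by (rule card_1_singletonE)
    then show ?thesis using ab T by (intro qsh_assoc_of_letter_tail[of a b t]) auto
  qed
qed (rule qsh_assoc_of_FR, blast)

end

theorem theorem3p12:
  fixes d :: "('a, 'r::comm_ring_1) diamond"
  assumes "contains_rat TYPE('r)"
    and "diamond_bilinear d"
    and "decomposable d"
    and "diamond_assoc d"
    and "diamond_tail_comm d"
  shows "\<forall>x y z. qsh d (qsh d x y) z = qsh d x (qsh d y z)"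
proof -
  interpret associative_diamond d
    by standard (use assms in auto)
  show ?thesis by (simp add: qsh_assoc)
qed

end
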